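(* Let $p>q>1$ be coprime integers. Then the subshift $\Xi_{p/q}$ is not synchronizing.
   Context: For $n\ge 2$ let $\Sigma_n=\{0,1,\dots,n-1\}$. For a finite alphabet $A$, $A^{\mathbb{Z}}$ carries the product topology, and $\sigma(x)[i]=x[i+1]$ is the shift map. A subshift is a nonempty closed $X\subseteq A^{\mathbb{Z}}$ with $\sigma(X)=X$. Its language $L(X)\subseteq A^*$ is the set of all finite words occurring as subwords of elements of $X$ (including the empty word). $X$ is transitive if for all $u,v\in L(X)$ there is $w\in L(X)$ with $uwv\in L(X)$. A word $w\in L(X)$ is synchronizing if for all $u,v\in L(X)$: $uw\in L(X)$ and $wv\in L(X)$ imply $uwv\in L(X)$. A transitive subshift $X$ is called synchronizing if $L(X)$ contains a synchronizing word. For coprime integers $s,t>1$, write $a,b\in\Sigma_{st}$ uniquely as $a=a_1t+a_0$, $b=b_1t+b_0$ with $a_0,b_0\in\Sigma_t$, $a_1,b_1\in\Sigma_s$, and put $g_{s,st}(a,b)=a_0s+b_1$. Let $f_{s/t,st}(a,c,b)=g_{s,st}(g_{s,st}(a,c),g_{s,st}(c,b))$. The multiplication automaton $\Pi_{s/t,st}:\Sigma_{st}^{\mathbb{Z}}\to\Sigma_{st}^{\mathbb{Z}}$ is $\Pi_{s/t,st}(x)[i]=f_{s/t,st}(x[i-1],x[i],x[i+1])$; it is a bijection with inverse $\Pi_{t/s,st}$ and it multiplies by $s/t$ in base $st$. The trace of $x\in\Sigma_{st}^{\mathbb{Z}}$ is $\mathrm{Tr}_{s/t}(x)\in\Sigma_{st}^{\mathbb{Z}}$,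 $\mathrm{Tr}_{s/t}(x)[k]=\Pi_{s/t,st}^k(x)[0]$ for $k\in\mathbb{Z}$, and the trace subshift is $\Xi_{s/t}=\mathrm{Tr}_{s/t}(\Sigma_{st}^{\mathbb{Z}})$. *)

theory Defs
  imports "HOL-Analysis.Analysis"
begin

type_synonym 'a config = "int \<Rightarrow> 'a"

definition full_shift :: "'a set \<Rightarrow> 'a config set" where
  "full_shift A = UNIV \<rightarrow> A"

definition config_topology :: "'a set \<Rightarrow> 'a config topology" where
  "config_topology A = product_topology (\<lambda>_. discrete_topology A) UNIV"

definition shift :: "'a config \<Rightarrow> 'a config" where
  "shift x = (\<lambda>i. x (i + 1))"

text \<open>\<open>closedin\<close> entails that \<open>X\<close> is contained in \<open>full_shift A\<close>,
  see \<open>topspace_config_topology\<close>.\<close>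

definition subshift :: "'a set \<Rightarrow> 'a config set \<Rightarrow> bool" where
  "subshift A X \<longleftrightarrow>
     finite A \<and> X \<noteq> {} \<and> closedin (config_topology A) X \<and> shift ` X = X"

definition subword :: "'a config \<Rightarrow> int \<Rightarrow> nat \<Rightarrow> 'a list" where
  "subword x i n = map (\<lambda>k. x (i + int k)) [0..<n]"

definition language :: "'a config set \<Rightarrow> 'a list set" where
  "language X = {subword x i n | x i n. x \<in> X}"

definition transitive_shift :: "'a config set \<Rightarrow> bool" where
  "transitive_shift X \<longleftrightarrow>
     (\<forall>u\<in>language X. \<forall>v\<in>language X. \<exists>w\<in>language X. u @ w @ v \<in> language X)"

definition synchronizing_word :: "'a config set \<Rightarrow> 'a list \<Rightarrow> bool" where
  "synchronizing_word X w \<longleftrightarrow> w \<in> language X \<and>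
     (\<forall>u\<in>language X. \<forall>v\<in>language X.
        u @ w \<in> language X \<longrightarrow> w @ v \<in> language X \<longrightarrow> u @ w @ v \<in> language X)"

definition synchronizing :: "'a set \<Rightarrow> 'a config set \<Rightarrow> bool" where
  "synchronizing A X \<longleftrightarrow>
     subshift A X \<and> transitive_shift X \<and> (\<exists>w. synchronizing_word X w)"

text \<open>For \<open>a = a\<^sub>1 * t + a\<^sub>0\<close> and \<open>b = b\<^sub>1 * t + b\<^sub>0\<close> with \<open>a\<^sub>0, b\<^sub>0 < t\<close>
  the value is \<open>a\<^sub>0 * s + b\<^sub>1\<close>; the base \<open>s * t\<close> is determined by the two parameters.\<close>

definition mult_rule :: "nat \<Rightarrow> nat \<Rightarrow> nat \<Rightarrow> nat \<Rightarrow> nat" where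
  "mult_rule s t a b = (a mod t) * s + b div t"

definition frac_rule :: "nat \<Rightarrow> nat \<Rightarrow> nat \<Rightarrow> nat \<Rightarrow> nat \<Rightarrow> nat" where
  "frac_rule s t a c b = mult_rule s t (mult_rule s t a c) (mult_rule s t c b)"

definition mult_automaton :: "nat \<Rightarrow> nat \<Rightarrow> nat config \<Rightarrow> nat config" where
  "mult_automaton s t x = (\<lambda>i. frac_rule s t (x (i - 1)) (x i) (x (i + 1)))"

text \<open>Integer iterates of a bijection \<open>f\<close> of the set \<open>S\<close>. For the multiplication automaton,
  bijectivity is \<open>mult_automaton_bij\<close> below.\<close>

definition int_iterate :: "'b set \<Rightarrow> ('b \<Rightarrow> 'b) \<Rightarrow> int \<Rightarrow> 'b \<Rightarrow> 'b" where
  "int_iterate S f k = (if 0 \<le> k then f ^^ nat k else inv_into S f ^^ nat (- k))"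

definition trace_config :: "nat \<Rightarrow> nat \<Rightarrow> nat config \<Rightarrow> nat config" where
  "trace_config s t x =
     (\<lambda>k. int_iterate (full_shift {..<s * t}) (mult_automaton s t) k x 0)"

definition trace_subshift :: "nat \<Rightarrow> nat \<Rightarrow> nat config set" where
  "trace_subshift s t = trace_config s t ` full_shift {..<s * t}"

lemma topspace_config_topology: "topspace (config_topology A) = full_shift A"
  by (simp add: config_topology_def full_shift_def PiE_UNIV_domain)

lemma in_full_shift_iff: "x \<in> full_shift A \<longleftrightarrow> (\<forall>i. x i \<in> A)"
  by (auto simp: full_shift_def)

lemma mult_rule_less:
  assumes "a < s * t" "b < s * t" shows "mult_rule s t a b < s * t"
proof -
  have t: "t > 0" and s: "s > 0" using assms by (auto intro: gr0I)
  have "b div t < s" using assms(2) by (simp add: less_mult_imp_div_less)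
  moreover have "a mod t \<le> t - 1" using t by (simp add: Suc_leI less_Suc_eq_le[symmetric])
  then have "(a mod t) * s \<le> (t - 1) * s" by (rule mult_le_mono1)
  moreover have "(t - 1) * s + s = s * t" using t by (cases t) (auto simp: algebra_simps)
  ultimately show ?thesis unfolding mult_rule_def by linarith
qed

lemma mult_rule_cancel:
  assumes "s > 0" "t > 0" "a < s * t" "b < s * t" "c < s * t"
  shows "mult_rule t s (mult_rule s t a b) (mult_rule s t b c) = b"
proof -
  have "b div t < s" "c div t < s" using assms by (simp_all add: less_mult_imp_div_less)
  then show ?thesis using assms by (simp add: mult_rule_def)
qed

lemma mult_automaton_in:
  assumes "x \<in> full_shift {..<s * t}" shows "mult_automaton s t x \<in> full_shift {..<s * t}"
  using assms by (auto simp: in_full_shift_iff mult_automaton_def frac_rule_def mult_rule_less)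

lemma mult_automaton_inverse:
  assumes st: "s > 0" "t > 0" and x: "x \<in> full_shift {..<s * t}"
  shows "mult_automaton t s (mult_automaton s t x) = x"
proof
  fix i
  have X: "x j < s * t" for j using x by (auto simp: in_full_shift_iff)
  define y where "y j = mult_rule s t (x j) (x (j + 1))" for j
  have Y: "y j < s * t" for j by (simp add: y_def X mult_rule_less)
  have A: "mult_automaton s t x j = mult_rule s t (y (j - 1)) (y j)" for j
    by (simp add: mult_automaton_def frac_rule_def y_def)
  have B: "mult_rule t s (mult_automaton s t x j) (mult_automaton s t x (j + 1)) = y j" for j
    using mult_rule_cancel[OF st Y Y Y, of "j - 1" j "j + 1"] by (simp add: A)
  have "mult_automaton t s (mult_automaton s t x) i = mult_rule t s (y (i - 1)) (y i)"
    using B[of "i - 1"] B[of i] by (simp add: mult_automaton_def[of t s] frac_rule_def)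
  also have "\<dots> = x i"
    using mult_rule_cancel[OF st X X X, of "i - 1" i "i + 1"] by (simp add: y_def)
  finally show "mult_automaton t s (mult_automaton s t x) i = x i" .
qed

lemma mult_automaton_bij:
  assumes "s > 0" "t > 0"
  shows "bij_betw (mult_automaton s t) (full_shift {..<s * t}) (full_shift {..<s * t})"
  using assms mult_automaton_in[of _ s t] mult_automaton_in[of _ t s]
    mult_automaton_inverse[of s t] mult_automaton_inverse[of t s]
  by (intro bij_betw_byWitness[where f' = "mult_automaton t s"]) (auto simp: mult.commute)

lemma inv_mult_automaton:
  assumes "s > 0" "t > 0" "x \<in> full_shift {..<s * t}"
  shows "inv_into (full_shift {..<s * t}) (mult_automaton s t) x = mult_automaton t s x"
  using assms mult_automaton_bij[of s t] mult_automaton_in[of x t s] mult_automaton_inverse[of t s x]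
  by (intro inv_into_f_eq) (auto simp: mult.commute bij_betw_def)

lemma mult_automaton_funpow_in:
  assumes "x \<in> full_shift {..<s * t}"
  shows "(mult_automaton s t ^^ n) x \<in> full_shift {..<s * t}"
  using assms by (induction n) (auto simp: mult_automaton_in)

lemma int_iterate_mult_automaton:
  assumes st: "s > 0" "t > 0" and x: "x \<in> full_shift {..<s * t}"
  shows "int_iterate (full_shift {..<s * t}) (mult_automaton s t) k x =
    (if 0 \<le> k then (mult_automaton s t ^^ nat k) x else (mult_automaton t s ^^ nat (- k)) x)"
proof -
  have "(inv_into (full_shift {..<s * t}) (mult_automaton s t) ^^ n) x = (mult_automaton t s ^^ n) x" for n
  proof (induction n)
    case (Suc n)
    then show ?case
      using inv_mult_automaton[OF st, of "(mult_automaton t s ^^ n) x"]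
        mult_automaton_funpow_in[of x t s n] x by (simp add: mult.commute)
  qed simp
  then show ?thesis by (simp add: int_iterate_def)
qed

lemma continuous_map_mult_automaton:
  "continuous_map (config_topology {..<s * t}) (config_topology {..<s * t}) (mult_automaton s t)"
proof -
  let ?D = "discrete_topology {..<s * t}" and ?T = "config_topology {..<s * t}"
  have pr: "continuous_map ?T ?D (\<lambda>x. x i)" for i
    unfolding config_topology_def by (rule continuous_map_product_projection) simp
  have "continuous_map ?T ?D (\<lambda>x. mult_automaton s t x i)" for i
  proof -
    have p: "continuous_map ?T (prod_topology ?D (prod_topology ?D ?D))
        (\<lambda>x. (x (i - 1), x i, x (i + 1)))"
      by (intro continuous_map_pairedI pr)
    have q: "continuous_map (prod_topology ?D (prod_topology ?D ?D)) ?D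
        (\<lambda>(a, c, b). frac_rule s t a c b)"
      by (auto simp: prod_topology_discrete_topology[symmetric] frac_rule_def mult_rule_less)
    show ?thesis
      using continuous_map_compose[OF p q] by (simp add: o_def mult_automaton_def)
  qed
  then show ?thesis
    unfolding config_topology_def[of "{..<s * t}"]
    by (subst continuous_map_componentwise_UNIV) (simp add: config_topology_def)
qed

lemma continuous_map_trace_config:
  assumes st: "s > 0" "t > 0"
  shows "continuous_map (config_topology {..<s * t}) (config_topology {..<s * t}) (trace_config s t)"
proof -
  let ?D = "discrete_topology {..<s * t}" and ?T = "config_topology {..<s * t}"
  have pow: "continuous_map ?T ?T f \<Longrightarrow> continuous_map ?T ?T (f ^^ n)" for f n
  proof (induction n)
    case 0
    then show ?case by (simp add: id_def)
  next
    case (Suc n)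
    then show ?case using continuous_map_compose[of ?T ?T "f ^^ n" ?T f] by (simp add: o_def)
  qed
  have pr: "continuous_map ?T ?D (\<lambda>x. x 0)"
    unfolding config_topology_def by (rule continuous_map_product_projection) simp
  have coord: "continuous_map ?T ?D (\<lambda>x. trace_config s t x k)" for k
  proof (rule continuous_map_eq)
    let ?F = "if 0 \<le> k then mult_automaton s t ^^ nat k else mult_automaton t s ^^ nat (- k)"
    have "continuous_map ?T ?T ?F"
      using pow[OF continuous_map_mult_automaton, of "nat k"]
        pow[of "mult_automaton t s" "nat (- k)"] continuous_map_mult_automaton[of t s]
      by (simp add: mult.commute)
    from continuous_map_compose[OF this pr]
    show "continuous_map ?T ?D (\<lambda>x. ?F x 0)" by (simp add: o_def)
    show "?F x 0 = trace_config s t x k" if "x \<in> topspace ?T" for x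
      using that int_iterate_mult_automaton[OF st, of x k]
      by (simp add: topspace_config_topology trace_config_def)
  qed
  have "continuous_map ?T (product_topology (\<lambda>_. ?D) UNIV) (trace_config s t)"
    by (subst continuous_map_componentwise_UNIV) (simp add: coord)
  then show ?thesis by (simp add: config_topology_def)
qed

lemma shift_trace_config:
  assumes st: "s > 0" "t > 0" and x: "x \<in> full_shift {..<s * t}"
  shows "shift (trace_config s t x) = trace_config s t (mult_automaton s t x)"
proof
  fix k :: int
  consider "k \<ge> 0" | "k < 0" by linarith
  then show "shift (trace_config s t x) k = trace_config s t (mult_automaton s t x) k"
  proof cases
    case 1
    then have "nat (k + 1) = Suc (nat k)" by simp
    then show ?thesis
      using 1 int_iterate_mult_automaton[OF st x] int_iterate_mult_automaton[OF st mult_automaton_in[OF x]]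
      by (simp add: shift_def trace_config_def funpow_swap1)
  next
    case 2
    define n where "n = nat (- (k + 1))"
    have n: "nat (- k) = Suc n" using 2 by (simp add: n_def)
    have "(mult_automaton t s ^^ Suc n) (mult_automaton s t x) = (mult_automaton t s ^^ n) x"
      by (simp add: funpow_Suc_right mult_automaton_inverse[OF st x] del: funpow.simps)
    moreover have "trace_config s t x (k + 1) = (mult_automaton t s ^^ n) x 0"
      using 2 int_iterate_mult_automaton[OF st x, of "k + 1"]
      by (cases "k = -1") (auto simp: trace_config_def n_def)
    ultimately show ?thesis
      using 2 n int_iterate_mult_automaton[OF st mult_automaton_in[OF x], of k]
      by (simp add: shift_def trace_config_def)
  qed
qed

lemma subshift_trace_subshift:
  assumes st: "s > 0" "t > 0"
  shows "subshift {..<s * t} (trace_subshift s t)"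
proof -
  let ?T = "config_topology {..<s * t}"
  have "compact_space ?T" "Hausdorff_space ?T"
    by (simp_all add: config_topology_def compact_space_product_topology compact_space_discrete_topology
        Hausdorff_space_product_topology)
  then have "closedin ?T (trace_subshift s t)"
    using image_compactin[OF _ continuous_map_trace_config[OF st], of "full_shift {..<s * t}"]
    by (auto simp: trace_subshift_def compact_space_def topspace_config_topology
        intro: compactin_imp_closedin)
  moreover have "(\<lambda>_. 0) \<in> full_shift {..<s * t}" using st by (simp add: in_full_shift_iff)
  then have "trace_subshift s t \<noteq> {}" by (auto simp: trace_subshift_def)
  moreover have "shift ` trace_subshift s t = trace_subshift s t"
  proof -
    have "shift ` trace_subshift s t = trace_config s t ` mult_automaton s t ` full_shift {..<s * t}"
      unfolding trace_subshift_def image_image using shift_trace_config[OF st] by (intro image_cong) auto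
    then show ?thesis using mult_automaton_bij[OF st] by (simp add: bij_betw_def trace_subshift_def)
  qed
  ultimately show ?thesis by (simp add: subshift_def)
qed

end

theory Submission
  imports Defs
begin

text \<open>A word of the trace subshift depends only on a finite window of the configuration, so it can be
  read off a configuration that is the base \<open>n = p q\<close> expansion of a real number \<open>\<xi>\<close>; its \<open>k\<close>-th
  letter is then \<open>\<lfloor>(p/q)\<^sup>k \<xi>\<rfloor> mod n\<close>. Consecutive letters determine
  \<open>q \<lfloor>(p/q) \<xi>\<rfloor> - p \<lfloor>\<xi>\<rfloor> = p frac \<xi> - q frac ((p/q) \<xi>)\<close> modulo \<open>n\<close>, and hence exactly, as it
  lies in \<open>(-q, p)\<close>. So two reals with a common word have fractional parts whose difference is
  expanded by \<open>p/q\<close> at each step of the word.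

  Given a word \<open>w\<close> of \<open>\<xi>\<^sub>0\<close>, right continuity of the floor and coprimality yield an integer \<open>I\<close> such
  that \<open>(p/q)\<^sup>k I\<close> also has the word \<open>w\<close> and lies slightly above a translate \<open>\<xi>'\<close> of \<open>\<xi>\<^sub>0\<close> with word
  \<open>w\<close> and the same integer part. Let \<open>u\<close> be the word of length \<open>k\<close> of \<open>I\<close> and \<open>w v\<close> a long word of
  \<open>\<xi>'\<close>. Since \<open>I\<close> has the least possible fractional part, any real with word \<open>u w v\<close> has after \<open>k\<close>
  steps a fractional part at least that of \<open>(p/q)\<^sup>k I\<close>, whereas \<open>w v\<close> forces it to be close to that of
  \<open>\<xi>'\<close>, by expansion. So \<open>u w v\<close> is not in the language.\<close>

section \<open>Base \<open>n\<close> expansions and the automaton as multiplication\<close>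

text \<open>Index 0 carries the units digit and larger indices are less significant. Floor and
  \<open>mod\<close> give digits to negative reals as well, which occur among the integers and
  translates used later.\<close>

definition real_config :: "nat \<Rightarrow> real \<Rightarrow> nat config" where
  "real_config n \<xi> i = nat (\<lfloor>\<xi> * real n powi i\<rfloor> mod int n)"

definition orbit_word :: "nat \<Rightarrow> nat \<Rightarrow> real \<Rightarrow> nat \<Rightarrow> nat list" where
  "orbit_word p q \<xi> m = map (\<lambda>k. real_config (p * q) ((p / q) ^ k * \<xi>) 0) [0..<m]"

lemma real_config_0: "real_config n \<xi> 0 = nat (\<lfloor>\<xi>\<rfloor> mod int n)"
  by (simp add: real_config_def)

lemma real_config_in: "n > 0 \<Longrightarrow> real_config n \<xi> \<in> full_shift {..<n}"
  by (simp add: in_full_shift_iff real_config_def nat_less_iff)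

lemma real_config_minus_one:
  assumes "n > 0"
  shows "real_config n \<xi> (i - 1) = real_config n (\<xi> / n) i"
  using assms by (simp add: real_config_def power_int_diff)

text \<open>Since \<open>p * \<theta> = \<theta> * n / q\<close>, its floor is
  \<open>A div q\<close>. Substituting \<open>A = n * B + A mod n\<close> and dropping multiples of
  \<open>n\<close> leaves exactly the local rule applied to the two digits.\<close>

lemma mult_rule_real_config:
  assumes p: "p > 0" and q: "q > 0"
  shows "mult_rule p q (real_config (p * q) \<xi> i) (real_config (p * q) \<xi> (i + 1))
    = real_config (p * q) (real p * \<xi>) i"
proof -
  define n where "n = p * q"
  define \<theta> where "\<theta> = \<xi> * real n powi i"
  define A where "A = \<lfloor>\<theta> * n\<rfloor>"
  define B where "B = \<lfloor>\<theta>\<rfloor>"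
  have n: "n > 0" using p q by (simp add: n_def)
  have "\<theta> = \<theta> * n / real_of_int (int n)" using n by simp
  then have B: "B = A div int n"
    unfolding B_def A_def by (metis floor_divide_real_eq_div of_nat_0_le_iff)
  have "real p * \<theta> = \<theta> * n / real_of_int (int q)" using q by (simp add: n_def)
  then have C: "\<lfloor>real p * \<theta>\<rfloor> = A div int q"
    unfolding A_def by (metis floor_divide_real_eq_div of_nat_0_le_iff)
  have A: "A = int p * int q * B + A mod int n" 
    using B mult_div_mod_eq[of "int n" A] by (simp add: n_def)
  have "A div int q = int p * B + (A mod int n) div int q"
    using q by (subst A) (simp add: div_mult_self2 mult.assoc mult.left_commute[of _ "int q"])
  moreover have "int p * B = int p * (int q * (B div int q) + B mod int q)"
    by (simp only: mult_div_mod_eq)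
  then have "int p * B = int p * (B mod int q) + int p * (int q * (B div int q))"
    by (simp only: distrib_left add.commute)
  ultimately have D: "A div int q = int n * (B div int q) + (int p * (B mod int q) + (A mod int n) div int q)"
    by (simp add: n_def)
  have bnd: "int p * (B mod int q) + (A mod int n) div int q < int n" 
            "0 \<le> int p * (B mod int q) + (A mod int n) div int q"
  proof -
    have "B mod int q \<le> int q - 1" using q by simp
    then have "int p * (B mod int q) \<le> int p * (int q - 1)" by (intro mult_left_mono) auto
    moreover have "(A mod int n) div int q < int p"
    proof -
      have "(A mod int n) div int q * int q \<le> A mod int n"
        using q by (simp flip: minus_mod_eq_div_mult)
      also have "\<dots> < int p * int q" using n by (simp flip: n_def of_nat_mult)
      finally show ?thesis using q by simp
    qed
    ultimately show "int p * (B mod int q) + (A mod int n) div int q < int n"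
      by (simp add: n_def algebra_simps)
    show "0 \<le> int p * (B mod int q) + (A mod int n) div int q"
      using p q n by (intro add_nonneg_nonneg mult_nonneg_nonneg) (auto simp: pos_imp_zdiv_nonneg_iff)
  qed
  have E: "(A div int q) mod int n = int p * (B mod int q) + (A mod int n) div int q"
    unfolding D using bnd by simp
  have "real_config n \<xi> i = nat (B mod int n)" by (simp add: real_config_def B_def \<theta>_def)
  moreover have "real_config n \<xi> (i + 1) = nat (A mod int n)"
    using n by (simp add: real_config_def A_def \<theta>_def power_int_add mult.assoc)
  moreover have "real_config n (real p * \<xi>) i = nat (A div int q mod int n)"
    by (simp add: real_config_def C[symmetric] \<theta>_def mult.assoc)
  moreover have "int (mult_rule p q (nat (B mod int n)) (nat (A mod int n)))
     = int p * (B mod int q) + (A mod int n) div int q"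
    using n by (simp add: mult_rule_def n_def zmod_int zdiv_int mod_mod_cancel)
  ultimately show ?thesis using E by (simp add: n_def)
qed

text \<open>The two nested applications of \<open>mult_rule\<close> multiply by \<open>p\<close>
  twice but are read at \<open>i - 1\<close>. Moving the index back to \<open>i\<close> divides by
  \<open>p * q\<close>, which leaves the factor \<open>p / q\<close>.\<close>

lemma mult_automaton_real_config:
  assumes p: "p > 0" and q: "q > 0"
  shows "mult_automaton p q (real_config (p * q) \<xi>) = real_config (p * q) (p / q * \<xi>)"
proof
  fix i
  have "mult_automaton p q (real_config (p * q) \<xi>) i
      = real_config (p * q) (real p * (real p * \<xi>)) (i - 1)"
    using mult_rule_real_config[OF p q, of \<xi> "i - 1"] mult_rule_real_config[OF p q, of \<xi> i]
      mult_rule_real_config[OF p q, of "real p * \<xi>" "i - 1"]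
    by (simp add: mult_automaton_def frac_rule_def)
  also have "\<dots> = real_config (p * q) (p / q * \<xi>) i"
    using p q by (subst real_config_minus_one) (auto simp: field_simps)
  finally show "mult_automaton p q (real_config (p * q) \<xi>) i = real_config (p * q) (p / q * \<xi>) i" .
qed

lemma mult_automaton_funpow_real_config:
  assumes "p > 0" and "q > 0"
  shows "(mult_automaton p q ^^ k) (real_config (p * q) \<xi>) = real_config (p * q) ((p / q) ^ k * \<xi>)"
  by (induction k) (use assms in \<open>simp_all add: mult_automaton_real_config mult.assoc\<close>)

section \<open>Finite windows and the language of the trace subshift\<close>

lemma ex_nat_with_digits:
  fixes f :: "nat \<Rightarrow> nat"
  assumes "\<And>e. f e < n"
  shows "\<exists>N. \<forall>e\<le>J. N div n ^ e mod n = f e"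
  using assms
proof (induction J arbitrary: f)
  case 0
  then show ?case by (intro exI[of _ "f 0"]) simp
next
  case (Suc J)
  obtain N where N: "\<forall>e\<le>J. N div n ^ e mod n = f (Suc e)"
    using Suc.IH[of "\<lambda>e. f (Suc e)"] Suc.prems by auto
  have "(f 0 + n * N) div n ^ e mod n = f e" if "e \<le> Suc J" for e
  proof (cases e)
    case 0
    then show ?thesis using Suc.prems by simp
  next
    case (Suc e')
    have "(f 0 + n * N) div n = N" using Suc.prems[of 0] by simp
    then show ?thesis using N Suc that by (simp add: div_mult2_eq)
  qed
  then show ?case by blast
qed

lemma ex_real_config_window:
  assumes x: "x \<in> full_shift {..<n}" and n: "n > 0"
  shows "\<exists>\<xi>. \<forall>i. \<bar>i\<bar> \<le> int m \<longrightarrow> real_config n \<xi> i = x i"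
proof -
  obtain N where N: "\<forall>e\<le>2 * m. N div n ^ e mod n = x (int m - int e)"
    using ex_nat_with_digits[of "\<lambda>e. x (int m - int e)" n "2 * m"] x by (auto simp: in_full_shift_iff)
  \<comment> \<open>Dividing by \<open>n ^ m\<close> moves digit \<open>e\<close> of
    \<open>N\<close> to index \<open>m - e\<close>, so the digits 0 to \<open>2 * m\<close> fill the
    window.\<close>
  have "real_config n (real N / real n ^ m) i = x i" if i: "\<bar>i\<bar> \<le> int m" for i
  proof -
    define e where "e = nat (int m - i)"
    have e: "i = int m - int e" "e \<le> 2 * m" using i by (auto simp: e_def)
    have "real N / real n ^ m * real n powi i = real N / real (n ^ e)"
      using n by (simp add: e(1) power_int_diff)
    also have "\<lfloor>\<dots>\<rfloor> = int (N div n ^ e)" by (rule floor_divide_of_nat_eq)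
    finally have "\<lfloor>real N / real n ^ m * real n powi i\<rfloor> mod int n = int (x i)"
      using N e by (metis zmod_int)
    then show ?thesis by (simp add: real_config_def)
  qed
  then show ?thesis by blast
qed

text \<open>The local rule has radius 1, so each step shrinks the window of agreement by one cell on
  either side.\<close>

lemma mult_automaton_funpow_local:
  assumes "\<And>i. \<bar>i\<bar> \<le> int m \<Longrightarrow> x i = y i" and "\<bar>i\<bar> + int k \<le> int m"
  shows "(mult_automaton p q ^^ k) x i = (mult_automaton p q ^^ k) y i"
  using assms(2)
proof (induction k arbitrary: i)
  case 0
  then show ?case using assms(1) by simp
next
  case (Suc k)
  have "(mult_automaton p q ^^ k) x j = (mult_automaton p q ^^ k) y j" if "j \<in> {i - 1, i, i + 1}" for j
    using that Suc.prems by (intro Suc.IH) auto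
  then show ?case by (simp add: mult_automaton_def[of p q "(mult_automaton p q ^^ k) _"])
qed

lemma funpow_shift: "(shift ^^ k) y i = y (i + int k)"
  by (induction k arbitrary: i) (auto simp: shift_def algebra_simps)

text \<open>Lets every word be read from index 0; for a negative start this takes a preimage under
  the shift, which is onto \<open>X\<close>.\<close>

lemma subword_eq_subword_0:
  assumes X: "shift ` X = X" and y: "y \<in> X"
  shows "\<exists>y'\<in>X. subword y i m = subword y' 0 m"
proof -
  have pow: "(shift ^^ k) ` X = X" for k
  proof (induction k)
    case (Suc k)
    have "(shift ^^ Suc k) ` X = shift ` (shift ^^ k) ` X" by (simp add: image_comp)
    then show ?case using Suc X by simp
  qed simp
  show ?thesis
  proof (cases "i \<ge> 0")
    case True
    have "(shift ^^ nat i) y \<in> X" using pow y by blast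
    then show ?thesis
      using True by (intro bexI[of _ "(shift ^^ nat i) y"]) (auto simp: subword_def funpow_shift add.commute)
  next
    case False
    obtain y' where "y' \<in> X" "y = (shift ^^ nat (- i)) y'" using pow[of "nat (- i)"] y by blast
    then show ?thesis
      using False by (intro bexI[of _ y']) (auto simp: subword_def funpow_shift)
  qed
qed

lemma subword_trace_config:
  assumes "p > 0" "q > 0" "x \<in> full_shift {..<p * q}"
  shows "subword (trace_config p q x) 0 m = map (\<lambda>k. (mult_automaton p q ^^ k) x 0) [0..<m]"
  by (simp add: subword_def trace_config_def int_iterate_mult_automaton[OF assms])

lemma language_trace_subshift:
  assumes p: "p > 0" and q: "q > 0"
  shows "language (trace_subshift p q) = range (\<lambda>(\<xi>, m). orbit_word p q \<xi> m)"
proof (intro equalityI subsetI)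
  fix w assume "w \<in> language (trace_subshift p q)"
  then obtain y i m where y: "y \<in> trace_subshift p q" and w: "w = subword y i m"
    by (auto simp: language_def)
  have "shift ` trace_subshift p q = trace_subshift p q"
    using subshift_trace_subshift[OF p q] by (simp add: subshift_def)
  from subword_eq_subword_0[OF this y] obtain x where x: "x \<in> full_shift {..<p * q}"
    and w': "w = subword (trace_config p q x) 0 m"
    using w by (auto simp: trace_subshift_def)
  obtain \<xi> where "\<And>i. \<bar>i\<bar> \<le> int m \<Longrightarrow> x i = real_config (p * q) \<xi> i"
    using ex_real_config_window[OF x, of m] p q by (metis nat_0_less_mult_iff)
  from mult_automaton_funpow_local[OF this, where i = 0 and p = p and q = q]
  have "w = orbit_word p q \<xi> m"
    unfolding w' subword_trace_config[OF p q x] orbit_word_def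
    by (simp add: mult_automaton_funpow_real_config[OF p q, symmetric])
  then show "w \<in> range (\<lambda>(\<xi>, m). orbit_word p q \<xi> m)" by auto
next
  fix w assume "w \<in> range (\<lambda>(\<xi>, m). orbit_word p q \<xi> m)"
  then obtain \<xi> m where w: "w = orbit_word p q \<xi> m" by auto
  let ?x = "real_config (p * q) \<xi>"
  have x: "?x \<in> full_shift {..<p * q}" using p q by (intro real_config_in) simp
  have "w = subword (trace_config p q ?x) 0 m"
    unfolding w subword_trace_config[OF p q x] orbit_word_def
    by (simp add: mult_automaton_funpow_real_config[OF p q])
  then show "w \<in> language (trace_subshift p q)"
    using x by (auto simp: language_def trace_subshift_def)
qed

lemma orbit_word_in_language:
  "p > 0 \<Longrightarrow> q > 0 \<Longrightarrow> orbit_word p q \<xi> m \<in> language (trace_subshift p q)"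
  by (auto simp: language_trace_subshift)

lemma length_orbit_word [simp]: "length (orbit_word p q \<xi> m) = m"
  by (simp add: orbit_word_def)

lemma orbit_word_add:
  "orbit_word p q \<xi> (a + b) = orbit_word p q \<xi> a @ orbit_word p q ((p / q) ^ a * \<xi>) b"
  unfolding orbit_word_def
  by (rule nth_equalityI)
     (auto simp: nth_append power_add[symmetric] mult.assoc[symmetric])

lemma orbit_word_eq_iff:
  assumes "p > 0" "q > 0"
  shows "orbit_word p q \<xi> m = orbit_word p q \<eta> m \<longleftrightarrow>
    (\<forall>k<m. \<lfloor>(p / q) ^ k * \<xi>\<rfloor> mod int (p * q) = \<lfloor>(p / q) ^ k * \<eta>\<rfloor> mod int (p * q))"
  using assms by (auto simp: orbit_word_def real_config_0 eq_nat_nat_iff)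

section \<open>Expansion of fractional parts\<close>

lemma frac_expand_step:
  assumes p: "p > 1" and q: "q > 1" 
    and 0: "\<lfloor>\<xi>\<rfloor> mod int (p * q) = \<lfloor>\<eta>\<rfloor> mod int (p * q)"
    and 1: "\<lfloor>p / q * \<xi>\<rfloor> mod int (p * q) = \<lfloor>p / q * \<eta>\<rfloor> mod int (p * q)"
  shows "frac (p / q * \<xi>) - frac (p / q * \<eta>) = p / q * (frac \<xi> - frac \<eta>)"
proof -
  define d where "d z = int q * \<lfloor>p / q * z\<rfloor> - int p * \<lfloor>z\<rfloor>" for z :: real
  \<comment> \<open>The terms \<open>p * z\<close> and \<open>q * (p / q * z)\<close> cancel, so
    only fractional parts remain.\<close>
  have d: "real_of_int (d z) = p * frac z - q * frac (p / q * z)" for z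
    using q by (simp add: d_def frac_def algebra_simps)
  have bound: "- int q < d z \<and> d z < int p" for z
  proof -
    have "p * frac z < p" "q * frac (p / q * z) < q"
      using p q by (simp_all add: frac_lt_1)
    moreover have "0 \<le> p * frac z" "0 \<le> q * frac (p / q * z)" by simp_all
    ultimately have "- real q < d z" "d z < real p" unfolding d by linarith+
    then show ?thesis by linarith
  qed
  have "int (p * q) dvd d \<xi> - d \<eta>"
  proof -
    have "d \<xi> - d \<eta> = int q * (\<lfloor>p / q * \<xi>\<rfloor> - \<lfloor>p / q * \<eta>\<rfloor>) - int p * (\<lfloor>\<xi>\<rfloor> - \<lfloor>\<eta>\<rfloor>)"
      by (simp add: d_def algebra_simps)
    moreover have "int p * int q dvd int q * (\<lfloor>p / q * \<xi>\<rfloor> - \<lfloor>p / q * \<eta>\<rfloor>)"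
      using 1 by (intro dvd_mult) (simp only: mod_eq_dvd_iff of_nat_mult)
    moreover have "int p * int q dvd int p * (\<lfloor>\<xi>\<rfloor> - \<lfloor>\<eta>\<rfloor>)"
      using 0 by (intro dvd_mult) (simp only: mod_eq_dvd_iff of_nat_mult)
    ultimately show ?thesis by (simp only: dvd_diff of_nat_mult)
  qed
  moreover have "\<bar>d \<xi> - d \<eta>\<bar> < int (p * q)"
  proof -
    \<comment> \<open>The sum equals \<open>p * q - p - q\<close>. Two values in
      \<open>(-q, p)\<close> differ by less than \<open>p + q\<close>, so congruence modulo
      \<open>p * q\<close> makes them equal.\<close>
    have "0 \<le> (int p - 2) * (int q - 2) + (int p - 2) + (int q - 2)"
      using p q by (intro add_nonneg_nonneg mult_nonneg_nonneg) simp_all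
    then have "int p + int q \<le> int (p * q)" by (simp add: algebra_simps)
    then show ?thesis using bound[of \<xi>] bound[of \<eta>] by linarith
  qed
  ultimately have "d \<xi> = d \<eta>" using dvd_imp_le_int[of "d \<xi> - d \<eta>" "int (p * q)"] by fastforce
  then have "p * frac \<xi> - q * frac (p / q * \<xi>) = p * frac \<eta> - q * frac (p / q * \<eta>)"
    by (metis d)
  then show ?thesis using q by (simp add: field_simps)
qed

text \<open>Each expansion step compares two consecutive letters, so \<open>k\<close> steps take
  \<open>Suc k\<close> common letters.\<close>

lemma frac_expand:
  assumes p: "p > 1" and q: "q > 1"
    and eq: "orbit_word p q \<xi> (Suc k) = orbit_word p q \<eta> (Suc k)"
  shows "frac ((p / q) ^ k * \<xi>) - frac ((p / q) ^ k * \<eta>) = (p / q) ^ k * (frac \<xi> - frac \<eta>)"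
  using eq
proof (induction k)
  case (Suc k)
  have E: "\<forall>j<Suc (Suc k). \<lfloor>(p / q) ^ j * \<xi>\<rfloor> mod int (p * q) = \<lfloor>(p / q) ^ j * \<eta>\<rfloor> mod int (p * q)"
    using Suc.prems p q by (subst (asm) orbit_word_eq_iff) auto
  have "orbit_word p q \<xi> (Suc k) = orbit_word p q \<eta> (Suc k)"
    using E p q by (subst orbit_word_eq_iff) auto
  note IH = Suc.IH[OF this]
  have "frac (p / q * ((p / q) ^ k * \<xi>)) - frac (p / q * ((p / q) ^ k * \<eta>))
      = p / q * (frac ((p / q) ^ k * \<xi>) - frac ((p / q) ^ k * \<eta>))"
    using E[rule_format, of k] E[rule_format, of "Suc k"]
    by (intro frac_expand_step[OF p q]) (simp_all add: mult.assoc)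
  then show ?case unfolding IH by (simp add: mult.assoc)
qed simp

section \<open>Right neighbourhoods, translates and integer orbits\<close>

lemma floor_right_constant:
  fixes \<xi> c :: real
  assumes c: "c > 0"
  shows "\<exists>\<delta>>0. \<forall>\<eta>\<in>{\<xi>..<\<xi> + \<delta>}. \<lfloor>c * \<eta>\<rfloor> = \<lfloor>c * \<xi>\<rfloor>"
\<comment> \<open>This is the distance from \<open>\<xi>\<close> to the next jump of the floor of
  \<open>c * \<eta>\<close>.\<close>
proof (intro exI[of _ "(1 - frac (c * \<xi>)) / c"] conjI ballI)
  show "(1 - frac (c * \<xi>)) / c > 0" using c frac_lt_1[of "c * \<xi>"] by simp
  fix \<eta> assume \<eta>: "\<eta> \<in> {\<xi>..<\<xi> + (1 - frac (c * \<xi>)) / c}"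
  then have "c * \<xi> \<le> c * \<eta>" using c by simp
  moreover have "c * \<eta> < c * \<xi> + (1 - frac (c * \<xi>))"
    using \<eta> c by (simp add: field_simps)
  ultimately show "\<lfloor>c * \<eta>\<rfloor> = \<lfloor>c * \<xi>\<rfloor>"
    unfolding frac_def by linarith
qed

lemma floor_powers_right_constant:
  fixes \<xi> c :: real
  assumes c: "c > 0"
  shows "\<exists>\<delta>>0. \<forall>\<eta>\<in>{\<xi>..<\<xi> + \<delta>}. \<forall>k<m::nat. \<lfloor>c ^ k * \<eta>\<rfloor> = \<lfloor>c ^ k * \<xi>\<rfloor>"
proof (induction m)
  case 0
  then show ?case by (intro exI[of _ 1]) simp
next
  case (Suc m)
  then obtain \<delta> where \<delta>: "\<delta> > 0" "\<forall>\<eta>\<in>{\<xi>..<\<xi> + \<delta>}. \<forall>k<m. \<lfloor>c ^ k * \<eta>\<rfloor> = \<lfloor>c ^ k * \<xi>\<rfloor>" by blast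
  obtain \<epsilon> where \<epsilon>: "\<epsilon> > 0" "\<forall>\<eta>\<in>{\<xi>..<\<xi> + \<epsilon>}. \<lfloor>c ^ m * \<eta>\<rfloor> = \<lfloor>c ^ m * \<xi>\<rfloor>"
    using floor_right_constant[of "c ^ m" \<xi>] c by auto
  have "\<lfloor>c ^ k * \<eta>\<rfloor> = \<lfloor>c ^ k * \<xi>\<rfloor>" if "\<eta> \<in> {\<xi>..<\<xi> + min \<delta> \<epsilon>}" "k < Suc m" for \<eta> k
  proof -
    have "\<eta> \<in> {\<xi>..<\<xi> + \<delta>}" "\<eta> \<in> {\<xi>..<\<xi> + \<epsilon>}" using that(1) by auto
    then show ?thesis using \<delta>(2) \<epsilon>(2) that(2) less_antisym by blast
  qed
  moreover have "min \<delta> \<epsilon> > 0" using \<delta>(1) \<epsilon>(1) by simp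
  ultimately show ?case by blast
qed

text \<open>The factor \<open>q ^ m\<close> clears the denominators \<open>q ^ k\<close> for all
  \<open>k < m\<close>, so every iterate is shifted by an integer multiple of
  \<open>p * q\<close>.\<close>

lemma orbit_word_translate:
  assumes p: "p > 0" and q: "q > 0"
  shows "orbit_word p q (\<xi> + of_int (int (p * q) * int q ^ m * t)) m = orbit_word p q \<xi> m"
proof (subst orbit_word_eq_iff[OF p q], intro allI impI)
  fix k assume "k < m"
  then have "real q ^ m = real q ^ (m - k) * real q ^ k"
    by (subst power_add[symmetric]) simp
  then have "(p / q) ^ k * (\<xi> + of_int (int (p * q) * int q ^ m * t))
      = (p / q) ^ k * \<xi> + of_int (int (p * q) * (int p ^ k * int q ^ (m - k) * t))"
    using q by (simp add: field_simps)
  then show "\<lfloor>(p / q) ^ k * (\<xi> + of_int (int (p * q) * int q ^ m * t))\<rfloor> mod int (p * q)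
      = \<lfloor>(p / q) ^ k * \<xi>\<rfloor> mod int (p * q)"
    by (simp only: floor_add_int[symmetric] mod_mult_self2)
qed

text \<open>Take \<open>z\<close> on the grid of multiples of \<open>p / q ^ k\<close>. Clearing
  denominators and cancelling one \<open>p\<close> turns the equation into a linear one in
  \<open>I\<close> and \<open>t\<close> with coprime coefficients \<open>p ^ k'\<close> and
  \<open>q ^ (m + k + 1)\<close>.\<close>

lemma ex_integer_orbit_near:
  fixes p q :: nat and \<xi> \<delta> :: real
  assumes cop: "coprime p q" and p: "p > 0" and q: "q > 1" and \<delta>: "\<delta> > 0"
  shows "\<exists>k (I :: int) t z. \<xi> < z \<and> z < \<xi> + \<delta> \<and>
    (p / q) ^ k * of_int I = z + of_int (int (p * q) * int q ^ m * t)"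
proof -
  obtain k' where k': "p / \<delta> < real q ^ k'" using real_arch_pow[of "real q"] q by auto
  define k where "k = Suc k'"
  have "real q ^ k' \<le> real q ^ k" using q by (intro power_increasing) (auto simp: k_def)
  then have "p / \<delta> < real q ^ k" using k' by linarith
  then have k: "p < real q ^ k * \<delta>" using \<delta> by (simp add: pos_divide_less_eq)
  \<comment> \<open>Adding 1 to the floor selects the first grid point strictly to the right of
    \<open>\<xi>\<close>.\<close>
  define c where "c = \<lfloor>real q ^ k * \<xi> / p\<rfloor> + 1"
  define z where "z = real p * c / real q ^ k"
  have "real q ^ k * \<xi> / p < c" "c \<le> real q ^ k * \<xi> / p + 1" unfolding c_def by linarith+
  then have "real q ^ k * \<xi> < p * c" "p * c \<le> real q ^ k * \<xi> + p" using p by (simp_all add: field_simps)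
  then have z: "\<xi> < z" "z < \<xi> + \<delta>" using k q by (simp_all add: z_def field_simps)
  have "coprime (int p ^ k') (int q ^ (m + k + 1))" using cop by simp
  then obtain a b where ab: "a * int p ^ k' + b * int q ^ (m + k + 1) = 1"
    using bezout_int[of "int p ^ k'" "int q ^ (m + k + 1)"] by (auto simp: coprime_iff_gcd_eq_1)
  define I where "I = c * a"
  define t where "t = - c * b"
  have "c * (a * int p ^ k' + b * int q ^ (m + k + 1)) = c" using ab by simp
  then have "int p ^ k' * I = c + int q ^ (m + k + 1) * t" by (simp add: I_def t_def algebra_simps)
  then have "real_of_int (int p ^ k' * I) = of_int (c + int q ^ (m + k + 1) * t)" by (rule arg_cong)
  then have "real p ^ k' * of_int I = of_int c + real q ^ (m + k + 1) * of_int t" by simp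
  then have "real p * (real p ^ k' * of_int I) = real p * (of_int c + real q ^ (m + k + 1) * of_int t)" by simp
  then have "(p / q) ^ k * of_int I = z + of_int (int (p * q) * int q ^ m * t)"
    using q by (simp add: z_def power_divide field_simps power_add k_def)
  with z show ?thesis by blast
qed

section \<open>Contradiction with a synchronizing word\<close>

theorem theorem3p21:
  fixes p q :: nat
  assumes "coprime p q" and "p > q" and "q > 1"
  shows "\<not> synchronizing {..<p * q} (trace_subshift p q)"
proof
  let ?L = "language (trace_subshift p q)" and ?\<beta> = "real p / real q"
  have p: "p > 0" "p > 1" and q: "q > 0" using assms by auto
  assume "synchronizing {..<p * q} (trace_subshift p q)"
  then obtain w where wL: "w \<in> ?L" 
    and sync: "\<And>u v. u \<in> ?L \<Longrightarrow> v \<in> ?L \<Longrightarrow> u @ w \<in> ?L \<Longrightarrow> w @ v \<in> ?L \<Longrightarrow> u @ w @ v \<in> ?L"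
    by (auto simp: synchronizing_def synchronizing_word_def)
  obtain \<xi> m where w: "w = orbit_word p q \<xi> m" using wL language_trace_subshift[OF p(1) q] by auto
  \<comment> \<open>\<open>Suc m\<close> keeps \<open>k = 0\<close> in range even for empty
    \<open>w\<close>, so that \<open>z\<close> and \<open>\<xi>\<close> have the same integer
    part.\<close>
  obtain \<delta> where \<delta>: "\<delta> > 0" "\<forall>\<eta>\<in>{\<xi>..<\<xi> + \<delta>}. \<forall>k<Suc m. \<lfloor>?\<beta> ^ k * \<eta>\<rfloor> = \<lfloor>?\<beta> ^ k * \<xi>\<rfloor>"
    using floor_powers_right_constant[of ?\<beta> \<xi> "Suc m"] p q by (auto simp del: power_Suc)
  obtain k I t z where z: "\<xi> < z" "z < \<xi> + \<delta>"
    and I: "?\<beta> ^ k * of_int I = z + of_int (int (p * q) * int q ^ m * t)"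
    using ex_integer_orbit_near[OF assms(1) p(1) assms(3) \<delta>(1), of \<xi> m]
    by (elim exE conjE) (rule that)
  define T where "T = int (p * q) * int q ^ m * t"
  have I_T: "?\<beta> ^ k * of_int I = z + of_int T" unfolding T_def by (rule I)
  define \<xi>' where "\<xi>' = \<xi> + of_int T"
  have z_floor: "\<forall>k<Suc m. \<lfloor>?\<beta> ^ k * z\<rfloor> = \<lfloor>?\<beta> ^ k * \<xi>\<rfloor>" 
    by (rule bspec[OF \<delta>(2)]) (use z in simp)
  then have "\<lfloor>?\<beta> ^ 0 * z\<rfloor> = \<lfloor>?\<beta> ^ 0 * \<xi>\<rfloor>" by blast
  then have floor_z: "\<lfloor>z\<rfloor> = \<lfloor>\<xi>\<rfloor>" by simp
  have w_z: "orbit_word p q (z + of_int T) m = w"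
    unfolding T_def w orbit_word_translate[OF p(1) q] orbit_word_eq_iff[OF p(1) q]
    using z_floor by (metis less_SucI)
  have w_\<xi>': "orbit_word p q \<xi>' m = w"
    unfolding \<xi>'_def T_def w orbit_word_translate[OF p(1) q] ..
  \<comment> \<open>After \<open>M\<close> expansions the gap \<open>z - \<xi>\<close> exceeds 1,
    too much for a difference of fractional parts.\<close>
  obtain M where M: "1 / (z - \<xi>) < ?\<beta> ^ M" using real_arch_pow[of ?\<beta>] assms by auto
  define u where "u = orbit_word p q (of_int I) k"
  define v where "v = orbit_word p q (?\<beta> ^ m * \<xi>') (Suc M)"
  have uw: "u @ w = orbit_word p q (of_int I) (k + m)"
    by (simp add: orbit_word_add I_T u_def w_z)
  have wv: "w @ v = orbit_word p q \<xi>' (m + Suc M)"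
    by (simp only: orbit_word_add w_\<xi>' v_def)
  have "u @ w @ v \<in> ?L"
    by (rule sync) (unfold uw wv, unfold u_def v_def, auto intro: orbit_word_in_language[OF p(1) q])
  then obtain \<eta> l where \<eta>: "u @ w @ v = orbit_word p q \<eta> l" 
    using language_trace_subshift[OF p(1) q] by auto
  have "l = length (u @ w @ v)" unfolding \<eta> by simp
  then have "l = k + Suc (m + M)" unfolding wv by (simp add: u_def)
  then have "u @ (w @ v) = orbit_word p q \<eta> k @ orbit_word p q (?\<beta> ^ k * \<eta>) (Suc (m + M))"
    using \<eta> by (simp only: orbit_word_add)
  then have \<eta>u: "orbit_word p q \<eta> k = orbit_word p q (of_int I) k"
    and \<eta>v: "orbit_word p q (?\<beta> ^ k * \<eta>) (Suc (m + M)) = orbit_word p q \<xi>' (Suc (m + M))"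
    unfolding wv by (simp_all add: u_def)
  have "\<lfloor>?\<beta> ^ k * \<eta>\<rfloor> mod int (p * q) = \<lfloor>\<xi>'\<rfloor> mod int (p * q)"
    using \<eta>v orbit_word_eq_iff[OF p(1) q] by force
  \<comment> \<open>The letter following \<open>u\<close> is thus also that of the orbit of
    \<open>I\<close>, which supplies the extra letter needed for \<open>k\<close>
    expansions.\<close>
  also have "\<lfloor>\<xi>'\<rfloor> = \<lfloor>?\<beta> ^ k * of_int I\<rfloor>" using floor_z by (simp add: I_T \<xi>'_def)
  finally have "orbit_word p q \<eta> (Suc k) = orbit_word p q (of_int I) (Suc k)"
    using \<eta>u by (simp add: orbit_word_eq_iff[OF p(1) q] less_Suc_eq del: of_nat_mult)
  \<comment> \<open>As \<open>frac (of_int I) = 0\<close>, the expanded difference is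
    \<open>?\<beta> ^ k * frac \<eta>\<close>, which is nonnegative.\<close>
  from frac_expand[OF p(2) assms(3) this]
  have "frac (?\<beta> ^ k * \<eta>) \<ge> frac (?\<beta> ^ k * of_int I)"
    by (simp only: frac_of_int diff_0_right diff_eq_eq)
      (simp only: le_add_same_cancel2 mult_nonneg_nonneg frac_ge_0 zero_le_power zero_le_divide_iff
        of_nat_0_le_iff simp_thms)
  moreover have "frac (?\<beta> ^ k * of_int I) - frac \<xi>' = z - \<xi>"
    using floor_z by (simp add: I_T \<xi>'_def frac_def)
  ultimately have "frac (?\<beta> ^ k * \<eta>) - frac \<xi>' \<ge> z - \<xi>" by linarith
  then have "?\<beta> ^ (m + M) * (z - \<xi>) \<le> ?\<beta> ^ (m + M) * (frac (?\<beta> ^ k * \<eta>) - frac \<xi>')"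
    by (intro mult_left_mono) simp_all
  also have "\<dots> = frac (?\<beta> ^ (m + M) * (?\<beta> ^ k * \<eta>)) - frac (?\<beta> ^ (m + M) * \<xi>')"
    by (rule frac_expand[OF p(2) assms(3) \<eta>v, symmetric])
  also have "\<dots> < 1" by (smt (verit) frac_lt_1 frac_ge_0)
  finally have "?\<beta> ^ (m + M) * (z - \<xi>) < 1" .
  moreover have "?\<beta> ^ M \<le> ?\<beta> ^ (m + M)" using assms by (intro power_increasing) auto
  then have "?\<beta> ^ M * (z - \<xi>) \<le> ?\<beta> ^ (m + M) * (z - \<xi>)" using z by (intro mult_right_mono) auto
  moreover have "1 < ?\<beta> ^ M * (z - \<xi>)" using M z by (simp add: field_simps)
  ultimately show False by linarith
qed

end
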